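(* For every integer $n>0$, $$\int_{-\pi/2}^{\pi/2}\frac{\sin\bigl((\pi/2)\cos\theta-(2n+1)\theta\bigr)\,e^{-(\pi/2)\sin\theta}}{\cosh(\pi\sin\theta)-\cos(\pi\cos\theta)}\,d\theta=0 .$$ *)

theory Defs
  imports "HOL-Analysis.Analysis"
begin

end

theory Submission
  imports Defs "HOL-Complex_Analysis.Cauchy_Integral_Formula"
begin

text \<open>
  Write \<open>z = cis \<theta>\<close> and \<open>w = \<pi> z / 2\<close>.  The denominator is \<open>2 \<bar>sin w\<bar>\<^sup>2\<close> and the
  numerator is the imaginary part of \<open>exp (\<i> w) / z ^ (2 n + 1)\<close>.  Adding to the integrand its
  reflection under \<open>\<theta> \<mapsto> - \<theta>\<close> turns \<open>exp (\<i> w)\<close> into \<open>exp (\<i> w) - exp (- \<i> w) = 2 \<i> sin w\<close>, so that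
  one factor of \<open>\<bar>sin w\<bar>\<^sup>2\<close> cancels and the sum is \<open>Re (z ^ (2 n + 1) / sin w)\<close>
  (\<open>integrand_plus_reflection\<close>).

  This is the real part of \<open>z * g z\<close> with \<open>g z = z ^ (2 n) / sin (\<pi> z / 2)\<close>.  As \<open>n > 0\<close>, the simple
  zero of the sine at the origin is absorbed and \<open>g\<close> is holomorphic on the disc of radius 2.  Since
  \<open>g\<close> is odd, it has an even primitive there, which takes equal values at the end points
  \<open>- \<i>\<close> and \<open>\<i>\<close> of the half circle; hence the symmetrised integral vanishes
  (\<open>half_circle_integral_odd\<close>), and the original one is half of it.
\<close>

lemma sin_half_pi_nonzero:
  fixes z :: complex
  assumes "z \<noteq> 0" "norm z < 2"
  shows "sin (of_real (pi / 2) * z) \<noteq> 0"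
proof
  assume "sin (of_real (pi / 2) * z) = 0"
  then obtain k :: int where k: "of_real (pi / 2) * z = of_real (of_int k * pi)"
    by (auto simp: sin_eq_0)
  have "of_real pi * z = of_real pi * (2 * of_int k)"
    using k by (simp add: field_simps)
  then have z: "z = 2 * of_int k"
    by simp
  have "norm z = 2 * \<bar>of_int k\<bar>"
    unfolding z by (simp add: norm_mult)
  with assms(2) have "k = 0"
    by simp
  with z assms(1) show False
    by simp
qed

text \<open>
  At the origin the quotient has the default value 0, which is also its limit there because the
  numerator has a zero of higher order; so the singularity is removable without redefining it.
\<close>

lemma power_over_sin_holomorphic:
  assumes "k \<ge> 2"
  shows "(\<lambda>z. z ^ k / sin (of_real (pi / 2) * z)) holomorphic_on ball 0 2"
    (is "?g holomorphic_on _")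
proof -
  have off0: "?g holomorphic_on (ball 0 2 - {0})"
    using sin_half_pi_nonzero by (auto intro!: holomorphic_intros)
  have "((\<lambda>z. sin (of_real (pi / 2) * z)) has_field_derivative of_real (pi / 2)) (at (0::complex))"
    by (auto intro!: derivative_eq_intros)
  then have "((\<lambda>z::complex. sin (of_real (pi / 2) * z) / z) \<longlongrightarrow> of_real (pi / 2)) (at 0)"
    by (simp add: has_field_derivative_iff)
  then have "((\<lambda>z::complex. z ^ (k - 1) / (sin (of_real (pi / 2) * z) / z))
      \<longlongrightarrow> 0 ^ (k - 1) / of_real (pi / 2)) (at 0)"
    by (intro tendsto_intros) auto
  moreover have "z ^ (k - 1) * z = z ^ k" for z :: complex
    using assms by (intro power_minus_mult) simp
  then have "(\<lambda>z::complex. z ^ (k - 1) / (sin (of_real (pi / 2) * z) / z)) = ?g"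
    by (simp only: divide_divide_eq_right)
  moreover have "(0::complex) ^ (k - 1) / of_real (pi / 2) = ?g 0"
    using assms by (simp add: power_0_left)
  ultimately have "(?g \<longlongrightarrow> ?g 0) (at 0)"
    by (simp only:)
  then have "isCont ?g 0"
    by (simp add: isCont_def)
  moreover have "isCont ?g z" if "z \<in> ball 0 2" "z \<noteq> 0" for z
    using sin_half_pi_nonzero[of z] that by (auto intro!: continuous_intros)
  ultimately have "isCont ?g z" if "z \<in> ball 0 2" for z
    using that by (cases "z = 0") (simp_all only:)
  then have cont: "continuous_on (ball 0 2) ?g"
    by (intro continuous_at_imp_continuous_on ballI)
  show ?thesis
    by (rule no_isolated_singularity[OF cont off0]) simp_all
qed

text \<open>
  Up to the factor \<open>\<i>\<close> this is the contour integral of \<open>g\<close> along the right half of the unit circle.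
  A primitive \<open>G\<close> of \<open>g\<close> is even, since \<open>G z - G (- z)\<close> has derivative \<open>g z + g (- z) = 0\<close> and
  vanishes at 0; and the end points of the half circle are negatives of each other.
\<close>

lemma half_circle_integral_odd:
  fixes g :: "complex \<Rightarrow> complex"
  assumes "g holomorphic_on ball 0 r" "r > 1" and odd: "\<And>z. g (- z) = - g z"
  shows "((\<lambda>\<theta>. cis \<theta> * g (cis \<theta>)) has_integral 0) {- pi / 2..pi / 2}"
proof -
  obtain G where G: "\<And>z. z \<in> ball 0 r \<Longrightarrow> (G has_field_derivative g z) (at z)"
    using holomorphic_convex_primitive'[OF convex_ball open_ball assms(1)] by (auto simp: at_within_open[OF _ open_ball])
  have "\<exists>c. \<forall>z\<in>ball 0 r. G z - G (- z) = c"
  proof (rule has_field_derivative_zero_constant)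
    fix z :: complex
    assume z: "z \<in> ball 0 r"
    then have "((\<lambda>z. G (- z)) has_field_derivative g (- z) * (- 1)) (at z)"
      by (intro DERIV_chain2[OF G]) (auto intro!: derivative_eq_intros)
    with G[OF z] have "((\<lambda>z. G z - G (- z)) has_field_derivative g z - g (- z) * (- 1)) (at z)"
      by (intro DERIV_diff)
    then show "((\<lambda>z. G z - G (- z)) has_field_derivative 0) (at z within ball 0 r)"
      by (simp add: odd has_field_derivative_at_within)
  qed simp
  then obtain c where c: "\<And>z. z \<in> ball 0 r \<Longrightarrow> G z - G (- z) = c"
    by blast
  have "G \<i> - G (- \<i>) = G 0 - G (- 0)"
    using c[of \<i>] c[of 0] assms(2) by simp
  then have even: "G \<i> = G (- \<i>)"
    by simp
  have "((\<lambda>\<theta>. \<i> * (cis \<theta> * g (cis \<theta>))) has_integral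
      G (cis (pi / 2)) - G (cis (- pi / 2))) {- pi / 2..pi / 2}"
  proof (rule fundamental_theorem_of_calculus)
    fix \<theta> :: real
    have "(cis has_vector_derivative \<i> * cis \<theta>) (at \<theta>)"
      by (auto intro!: derivative_eq_intros simp: has_vector_derivative_def scaleR_conv_of_real)
    then have "(G \<circ> cis has_vector_derivative (\<i> * cis \<theta>) * g (cis \<theta>)) (at \<theta>)"
      using G[of "cis \<theta>"] assms(2) by (intro field_vector_diff_chain_at) auto
    then show "((\<lambda>\<theta>. G (cis \<theta>)) has_vector_derivative \<i> * (cis \<theta> * g (cis \<theta>)))
        (at \<theta> within {- pi / 2..pi / 2})"
      by (simp add: o_def mult.assoc has_vector_derivative_at_within)
  qed simp
  then have "((\<lambda>\<theta>. \<i> * (cis \<theta> * g (cis \<theta>))) has_integral 0) {- pi / 2..pi / 2}"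
    using even by simp
  from has_integral_mult_right[OF this, of "- \<i>"] show ?thesis
    by (simp add: mult.assoc[symmetric])
qed

lemma cosh_minus_cos_eq:
  "cosh (2 * b) - cos (2 * a) = 2 * ((sin a * cosh b)\<^sup>2 + (cos a * sinh b)\<^sup>2)" for a b :: real
proof -
  have "cosh (2 * b) - cos (2 * a) = 2 * ((sin a)\<^sup>2 + (sinh b)\<^sup>2)"
    by (simp add: cosh_double cos_double_sin cosh_square_eq)
  also have "(sin a)\<^sup>2 + (sinh b)\<^sup>2 = (sin a * cosh b)\<^sup>2 + (cos a * sinh b)\<^sup>2"
    by (simp add: power_mult_distrib cosh_square_eq cos_squared_eq algebra_simps)
  finally show ?thesis .
qed

text \<open>
  With \<open>w = Complex a b\<close>, the denominator is \<open>2 * sin w * cnj (sin w)\<close> and the two numerators are the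
  imaginary parts of \<open>cis (- t) * exp (\<i> * w)\<close> and of \<open>- cis (- t) * exp (- \<i> * w)\<close>.  They add up to
  the imaginary part of \<open>cis (- t) * 2 * \<i> * sin w\<close>, in which \<open>sin w\<close> cancels; the right-hand side is
  the conjugate form of what remains.
\<close>

lemma reflected_sum_eq:
  fixes a b t :: real
  shows "sin (a - t) * exp (- b) / (cosh (2 * b) - cos (2 * a))
         + sin (a + t) * exp b / (cosh (2 * b) - cos (2 * a))
         = Re (cis t / sin (Complex a b))"
proof -
  have num: "sin (a - t) * exp (- b) + sin (a + t) * exp b
      = 2 * (cos t * (sin a * cosh b) + sin t * (cos a * sinh b))"
    by (simp add: sin_diff sin_add cosh_field_def sinh_field_def field_simps)
  have re: "Re (sin (Complex a b)) = sin a * cosh b" and im: "Im (sin (Complex a b)) = cos a * sinh b"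
    by (simp_all add: Re_sin Im_sin cosh_field_def sinh_field_def)
  show ?thesis
    unfolding add_divide_distrib[symmetric] num cosh_minus_cos_eq Re_divide re im
    by (simp del: distrib_left_numeral)
qed

definition integrand :: "nat \<Rightarrow> real \<Rightarrow> real" where
  "integrand N \<theta> = sin ((pi / 2) * cos \<theta> - (2 * of_nat N + 1) * \<theta>) * exp (- (pi / 2) * sin \<theta>)
            / (cosh (pi * sin \<theta>) - cos (pi * cos \<theta>))"

lemma integrand_plus_reflection:
  "integrand N \<theta> + integrand N (- \<theta>)
   = Re (cis \<theta> * (cis \<theta> ^ (2 * N) / sin (of_real (pi / 2) * cis \<theta>)))"
proof -
  have "of_real (pi / 2) * cis \<theta> = Complex (pi / 2 * cos \<theta>) (pi / 2 * sin \<theta>)"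
    by (simp add: complex_eq_iff)
  moreover have "cis \<theta> * cis \<theta> ^ (2 * N) = cis ((2 * of_nat N + 1) * \<theta>)"
    by (simp add: Complex.DeMoivre cis_mult algebra_simps)
  ultimately show ?thesis
    using reflected_sum_eq[of "pi / 2 * cos \<theta>" "(2 * of_nat N + 1) * \<theta>" "pi / 2 * sin \<theta>"]
    by (simp add: integrand_def)
qed

lemma denominator_nonzero: "cosh (pi * sin \<theta>) - cos (pi * cos \<theta>) \<noteq> 0"
proof -
  define s where "s = sin (of_real (pi / 2) * cis \<theta>)"
  have "of_real (pi / 2) * cis \<theta> = Complex (pi / 2 * cos \<theta>) (pi / 2 * sin \<theta>)"
    by (simp add: complex_eq_iff)
  then have "Re s = sin (pi / 2 * cos \<theta>) * cosh (pi / 2 * sin \<theta>)"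
    "Im s = cos (pi / 2 * cos \<theta>) * sinh (pi / 2 * sin \<theta>)"
    by (simp_all add: s_def Re_sin Im_sin cosh_field_def sinh_field_def)
  then have "cosh (pi * sin \<theta>) - cos (pi * cos \<theta>) = 2 * ((Re s)\<^sup>2 + (Im s)\<^sup>2)"
    using cosh_minus_cos_eq[of "pi / 2 * sin \<theta>" "pi / 2 * cos \<theta>"] by simp
  moreover have "s \<noteq> 0"
    unfolding s_def by (rule sin_half_pi_nonzero) auto
  ultimately show ?thesis
    by (simp add: complex_eq_iff sum_power2_eq_zero_iff del: distrib_left_numeral)
qed

theorem mainTheorem11:
  fixes n :: int
  assumes "n > 0"
  shows "((\<lambda>\<theta>::real. sin ((pi / 2) * cos \<theta> - (2 * of_int n + 1) * \<theta>) * exp (- (pi / 2) * sin \<theta>)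
            / (cosh (pi * sin \<theta>) - cos (pi * cos \<theta>))) has_integral 0) {- pi / 2..pi / 2}"
proof -
  define N where "N = nat n"
  define I where "I = integral {- pi / 2..pi / 2} (integrand N)"
  have "continuous_on {- pi / 2..pi / 2} (integrand N)"
    unfolding integrand_def cosh_field_def
    using denominator_nonzero by (intro continuous_intros) (auto simp: cosh_field_def)
  then have int: "(integrand N has_integral I) {- pi / 2..pi / 2}"
    unfolding I_def by (intro integrable_integral integrable_continuous_interval)
  moreover have "((\<lambda>\<theta>. integrand N (- \<theta>)) has_integral I) {- pi / 2..pi / 2}"
    using int has_integral_reflect_real[of "integrand N" I "pi / 2" "- pi / 2"] by simp
  ultimately have "((\<lambda>\<theta>. integrand N \<theta> + integrand N (- \<theta>)) has_integral I + I) {- pi / 2..pi / 2}"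
    by (rule has_integral_add)
  moreover have "((\<lambda>\<theta>. integrand N \<theta> + integrand N (- \<theta>)) has_integral Re 0) {- pi / 2..pi / 2}"
    unfolding integrand_plus_reflection
  proof (intro has_integral_Re half_circle_integral_odd[where r = 2])
    show "(\<lambda>z. z ^ (2 * N) / sin (of_real (pi / 2) * z)) holomorphic_on ball 0 2"
      using assms by (intro power_over_sin_holomorphic) (simp add: N_def)
  qed simp_all
  ultimately have "I + I = Re 0"
    by (rule has_integral_unique)
  with int show ?thesis
    using assms unfolding integrand_def by (simp add: N_def)
qed

end
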